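(* Let $a_2,a_3\in\mathbb{R}$, $b\in\mathbb{R}\setminus\{0\}$, $\sigma\in\{+1,-1\}$, and consider the three-stage stochastic Runge-Kutta (SRK) scheme ($s=3$) with coefficients $$A=\begin{pmatrix} a_1 & 0 & 0 \\ a_1-a_2 & a_2 & 0 \\ 1-a_3 & 0 & a_3 \end{pmatrix},\quad B^{(1)}=\begin{pmatrix} 0 & 0 & 0 \\ b & 0 & 0 \\ 1-\frac1{2b} & \frac1{2b} & 0 \end{pmatrix},\quad B^{(2)}=0,\quad B^{(3)}=\begin{pmatrix} 0 & 0 & 0 \\ -\sigma b & 0 & 0 \\ -\frac{\sigma}{2b} & \frac{\sigma}{2b} & 0 \end{pmatrix}$$ in the case $a_1=0$. If $a_2\ge0$ and $a_3\ge\frac32$ (and $b\in\mathbb{R}\setminus\{0\}$ is arbitrary), then this (strong order 1.0) scheme is $A$-stable for the linear test equation $\mathrm{d}X_t=\lambda X_t\,\mathrm{d}t+\mu X_t\,\mathrm{d}W_t$ ($\lambda,\mu\in\mathbb{C}$), i.e. $\mathcal{D}_{SDE}\subseteq\mathcal{D}_{SRK}$.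
   Context: A stiffly accurate $s$-stage SRK method with real $s\times s$ coefficient matrices $A,B^{(1)},B^{(2)},B^{(3)}$, applied with constant step size $h>0$ to the scalar test equation $\mathrm{d}X_t=\lambda X_t\,\mathrm{d}t+\mu X_t\,\mathrm{d}W_t$ ($W$ a real Wiener process, Itô sense, $\lambda,\mu\in\mathbb{C}$), computes stages $H=(H_1,\dots,H_s)^T$ from $$H=e\,y_n+\lambda hAH+\mu\Big(I_{(1),n}B^{(1)}+\tfrac{I_{(1,1),n}}{\sqrt h}B^{(2)}+\sqrt h\,B^{(3)}\Big)H,\qquad y_{n+1}=H_s,$$ where $e=(1,\dots,1)^T\in\mathbb{R}^s$, $I_{(1),n}=\sqrt h\,\xi_n$ with $\xi_n\sim N(0,1)$ independent, and $I_{(1,1),n}=\frac12(I_{(1),n}^2-h)$. With $\hat h=\lambda h$ and $k=\mu\sqrt h$ this gives $y_{n+1}=R_n(\hat h,k)\,y_n$, with stability function $$R_n(\hat h,k)=\varepsilon_s^T\Big(I_s-\hat hA-k\big(\xi_nB^{(1)}+\tfrac12(\xi_n^2-1)B^{(2)}+B^{(3)}\big)\Big)^{-1}e,\qquad \varepsilon_s=(0,\dots,0,1)^T\in\mathbb{R}^s,$$ $I_s$ the identity matrix, defined wherever the inverse exists. Put $\hat R(\hat h,k)=\mathrm{E}(|R_n(\hat h,k)|^2)$. Domains of mean-square stability: $\mathcal{D}_{SDE}=\{(\lambda,\mu)\in\mathbb{C}^2: 2\Re(\lambda)+|\mu|^2<0\}$ and $\mathcal{D}_{SRK}=\{(\hat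 h,k)\in\mathbb{C}^2:\hat R(\hat h,k)<1\}$. The method is called $A$-stable if $\mathcal{D}_{SDE}\subseteq\mathcal{D}_{SRK}$, i.e. if $\hat R(\hat h,k)<1$ for all $(\hat h,k)\in\mathbb{C}^2$ with $2\Re(\hat h)+|k|^2<0$. *)

theory Defs
  imports "HOL-Probability.Probability"
begin

text \<open>
  An SRK method with stages indexed by a finite type. The output stage (the index \<open>s\<close> of
  \<open>y\<^sub>n\<^sub>+\<^sub>1 = H\<^sub>s\<close>) is part of the data, because the order on a numeral type does not single it
  out: on type 3 the numeral 3 equals 0 and is the least element.
\<close>

record 's srk =
  matA :: "real ^ 's ^ 's"
  matB1 :: "real ^ 's ^ 's"
  matB2 :: "real ^ 's ^ 's"
  matB3 :: "real ^ 's ^ 's"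
  out_stage :: 's

text \<open>
  The stage equations of one step from \<open>y\<close>, for \<open>dX = \<lambda> X dt + \<mu> X dW\<close>; \<open>I1\<close> is the value
  of the Wiener increment and \<open>(I1\<^sup>2 - h) / 2\<close> the iterated Ito integral.
\<close>

definition srk_stages ::
  "('s::finite) srk \<Rightarrow> complex \<Rightarrow> complex \<Rightarrow> real \<Rightarrow> real \<Rightarrow> complex \<Rightarrow> complex ^ 's \<Rightarrow> bool" where
  "srk_stages S lam mu h I1 y H \<longleftrightarrow>
     (\<forall>i. H $ i = y
        + lam * of_real h * (\<Sum>j\<in>UNIV. of_real (matA S $ i $ j) * H $ j)
        + mu * (\<Sum>j\<in>UNIV. of_real (I1 * matB1 S $ i $ j
             + ((I1\<^sup>2 - h) / 2) / sqrt h * matB2 S $ i $ j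
             + sqrt h * matB3 S $ i $ j) * H $ j))"

definition stage_matrix ::
  "('s::finite) srk \<Rightarrow> complex \<Rightarrow> complex \<Rightarrow> real \<Rightarrow> complex ^ 's ^ 's" where
  "stage_matrix S hh k \<xi> =
     (\<chi> i j. mat 1 $ i $ j - hh * of_real (matA S $ i $ j)
        - k * of_real (\<xi> * matB1 S $ i $ j + (\<xi>\<^sup>2 - 1) / 2 * matB2 S $ i $ j + matB3 S $ i $ j))"

definition stab_fun :: "('s::finite) srk \<Rightarrow> complex \<Rightarrow> complex \<Rightarrow> real \<Rightarrow> complex" where
  "stab_fun S hh k \<xi> = (matrix_inv (stage_matrix S hh k \<xi>) *v (\<chi> i. 1)) $ out_stage S"

lemma srk_stages_stab_fun:
  fixes S :: "('s::finite) srk"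
  assumes "h > 0" and inv: "invertible (stage_matrix S (lam * of_real h) (mu * of_real (sqrt h)) \<xi>)"
    and H: "srk_stages S lam mu h (sqrt h * \<xi>) y H"
  shows "H $ out_stage S = stab_fun S (lam * of_real h) (mu * of_real (sqrt h)) \<xi> * y"
proof -
  let ?M = "stage_matrix S (lam * of_real h) (mu * of_real (sqrt h)) \<xi>"
  have r: "((sqrt h * \<xi>)\<^sup>2 - h) / 2 / sqrt h = sqrt h * ((\<xi>\<^sup>2 - 1) / 2)"
  proof -
    define q where "q = sqrt h"
    have "q > 0" and h: "h = q\<^sup>2"
      using \<open>h > 0\<close> by (auto simp: q_def)
    have *: "((q * \<xi>)\<^sup>2 - q\<^sup>2) / 2 / q = q * ((\<xi>\<^sup>2 - 1) / 2)"
      using \<open>q > 0\<close> by (simp add: field_simps power2_eq_square)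
    then show ?thesis
      unfolding q_def[symmetric] by (subst h) (rule *)
  qed
  have "(?M *v H) $ i = y" for i
  proof -
    let ?c = "\<lambda>j. \<xi> * matB1 S $ i $ j + (\<xi>\<^sup>2 - 1) / 2 * matB2 S $ i $ j + matB3 S $ i $ j"
    have c: "sqrt h * \<xi> * matB1 S $ i $ j + ((sqrt h * \<xi>)\<^sup>2 - h) / 2 / sqrt h * matB2 S $ i $ j
        + sqrt h * matB3 S $ i $ j = sqrt h * ?c j" for j
      unfolding r by (simp add: algebra_simps)
    have "(?M *v H) $ i = (\<Sum>j\<in>UNIV. mat 1 $ i $ j * H $ j)
       - lam * of_real h * (\<Sum>j\<in>UNIV. of_real (matA S $ i $ j) * H $ j)
       - mu * (\<Sum>j\<in>UNIV. of_real (sqrt h * ?c j) * H $ j)"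
      unfolding stage_matrix_def matrix_vector_mult_def sum_distrib_left
      by (simp only: sum_subtractf[symmetric] vec_lambda_beta of_real_mult)
         (rule sum.cong, simp, simp only: left_diff_distrib mult.assoc)
    also have "(\<Sum>j\<in>UNIV. mat 1 $ i $ j * H $ j) = H $ i"
      using matrix_vector_mul_lid[of H] by (simp add: matrix_vector_mult_def vec_eq_iff)
    finally have 1: "(?M *v H) $ i = H $ i
       - lam * of_real h * (\<Sum>j\<in>UNIV. of_real (matA S $ i $ j) * H $ j)
       - mu * (\<Sum>j\<in>UNIV. of_real (sqrt h * ?c j) * H $ j)" .
    have 2: "H $ i = y + lam * of_real h * (\<Sum>j\<in>UNIV. of_real (matA S $ i $ j) * H $ j)
       + mu * (\<Sum>j\<in>UNIV. of_real (sqrt h * ?c j) * H $ j)"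
      using H[unfolded srk_stages_def, THEN spec, of i] unfolding c .
    have aux: "u = y" if "u = x - p - q" "x = y + p + q" for u x p q :: complex
      using that by simp
    show ?thesis
      by (rule aux[OF 1 2])
  qed
  then have MH: "?M *v H = y *s (\<chi> i. 1)"
    by (simp add: vec_eq_iff)
  have "matrix_inv ?M ** ?M = mat 1"
    using someI_ex[OF inv[unfolded invertible_def]] unfolding matrix_inv_def by (rule conjunct2)
  then have "H = matrix_inv ?M *v (?M *v H)"
    by (simp add: matrix_vector_mul_assoc)
  also have "\<dots> = y *s (matrix_inv ?M *v (\<chi> i. 1))"
    unfolding MH by (simp add: matrix_vector_mult_def vec_eq_iff sum_distrib_left mult.commute)
  finally have "H $ out_stage S = (y *s (matrix_inv ?M *v (\<chi> i. 1))) $ out_stage S"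
    by (rule arg_cong)
  then show ?thesis
    by (simp add: stab_fun_def mult.commute)
qed

definition ms_stab_fun :: "('s::finite) srk \<Rightarrow> complex \<Rightarrow> complex \<Rightarrow> real" where
  "ms_stab_fun S hh k = (\<integral>\<xi>. (cmod (stab_fun S hh k \<xi>))\<^sup>2 \<partial>std_normal_distribution)"

definition dom_SDE :: "(complex \<times> complex) set" where
  "dom_SDE = {(lam, mu). 2 * Re lam + (cmod mu)\<^sup>2 < 0}"

text \<open>
  The Bochner integral is 0 for non-integrable functions and \<^const>\<open>matrix_inv\<close> is total, so
  the domain asks explicitly that the stability function is defined almost surely and has a
  finite second moment.
\<close>

definition dom_SRK :: "('s::finite) srk \<Rightarrow> (complex \<times> complex) set" where
  "dom_SRK S = {(hh, k).
     (AE \<xi> in std_normal_distribution. invertible (stage_matrix S hh k \<xi>)) \<and>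
     integrable std_normal_distribution (\<lambda>\<xi>. (cmod (stab_fun S hh k \<xi>))\<^sup>2) \<and>
     ms_stab_fun S hh k < 1}"

definition A_stable :: "('s::finite) srk \<Rightarrow> bool" where
  "A_stable S \<longleftrightarrow> dom_SDE \<subseteq> dom_SRK S"

definition srk3 :: "real \<Rightarrow> real \<Rightarrow> real \<Rightarrow> real \<Rightarrow> real \<Rightarrow> 3 srk" where
  "srk3 a1 a2 a3 b \<sigma> =
     \<lparr> matA = vector [vector [a1,      0,  0 ],
                      vector [a1 - a2, a2, 0 ],
                      vector [1 - a3,  0,  a3]],
       matB1 = vector [vector [0,               0,           0],
                       vector [b,               0,           0],
                       vector [1 - 1 / (2 * b), 1 / (2 * b), 0]],
       matB2 = 0,
       matB3 = vector [vector [0,                0,           0],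
                       vector [- \<sigma> * b,          0,           0],
                       vector [- (\<sigma> / (2 * b)), \<sigma> / (2 * b), 0]],
       out_stage = 3 \<rparr>"

end

theory Submission
  imports Defs
begin

text \<open>
  As \<open>a1 = 0\<close>, the stage matrix is lower triangular and the stability function is a quadratic
  polynomial in \<open>\<xi>\<close>. The Hermite polynomials \<open>1\<close>, \<open>\<xi>\<close>, \<open>\<xi>\<^sup>2 - 1\<close> are orthogonal under the
  standard normal distribution, with squared norms 1, 1, 2, so the mean-square stability
  function is a sum of three terms. Since \<open>Re hh < 0\<close>, the factor
  \<open>\<bar>1 - hh a2\<bar>\<^sup>2 \<ge> 1\<close> in a denominator can be dropped, and \<open>a3 \<ge> 3/2\<close> gives
  \<open>(1 - 2 a3) \<bar>hh\<bar>\<^sup>2 + \<bar>k\<bar>\<^sup>4 / 2 \<le> -2 \<bar>hh\<bar>\<^sup>2 + 2 (Re hh)\<^sup>2 \<le> 0\<close>.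
\<close>

lemma has_bochner_integral_std_normal_cmod_quadratic:
  fixes p q r :: complex
  shows "has_bochner_integral std_normal_distribution
    (\<lambda>x. (cmod (p + q * of_real x + r * of_real (x\<^sup>2 - 1)))\<^sup>2)
    ((cmod p)\<^sup>2 + (cmod q)\<^sup>2 + 2 * (cmod r)\<^sup>2)"
proof -
  let ?N = "std_normal_density"
  let ?f = "\<lambda>x. (cmod (p + q * of_real x + r * of_real (x\<^sup>2 - 1)))\<^sup>2"
  \<comment> \<open>Sorted by powers of \<open>x\<close>, the polynomial is
    \<open>(p - r) + q x + r x^2\<close>; \<open>c0\<close> to \<open>c4\<close> are the
    coefficients of its squared modulus, so only the normal moments 1, 0, 1, 0, 3 are
    needed.\<close>
  define c0 where "c0 = (cmod (p - r))\<^sup>2"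
  define c1 where "c1 = 2 * Re ((p - r) * cnj q)"
  define c2 where "c2 = (cmod q)\<^sup>2 + 2 * Re ((p - r) * cnj r)"
  define c3 where "c3 = 2 * Re (q * cnj r)"
  define c4 where "c4 = (cmod r)\<^sup>2"
  have m0: "has_bochner_integral lborel (\<lambda>x. ?N x * x ^ 0) 1"
    using std_normal_moment_even[of 0] by simp
  have m1: "has_bochner_integral lborel (\<lambda>x. ?N x * x ^ 1) 0"
    using std_normal_moment_odd[of 0] by simp
  have m2: "has_bochner_integral lborel (\<lambda>x. ?N x * x ^ 2) 1"
    using std_normal_moment_even[of 1] by simp
  have m3: "has_bochner_integral lborel (\<lambda>x. ?N x * x ^ 3) 0"
    using std_normal_moment_odd[of 1] by (simp add: numeral_3_eq_3)
  have m4: "has_bochner_integral lborel (\<lambda>x. ?N x * x ^ 4) 3"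
    using std_normal_moment_even[of 2] by (simp add: fact_numeral)
  have "has_bochner_integral lborel
      (\<lambda>x. c0 * (?N x * x ^ 0) + c1 * (?N x * x ^ 1) + c2 * (?N x * x ^ 2)
         + c3 * (?N x * x ^ 3) + c4 * (?N x * x ^ 4))
      (c0 * 1 + c1 * 0 + c2 * 1 + c3 * 0 + c4 * 3)"
    by (intro has_bochner_integral_add has_bochner_integral_mult_right m0 m1 m2 m3 m4)
  moreover have "c0 * (?N x * x ^ 0) + c1 * (?N x * x ^ 1) + c2 * (?N x * x ^ 2)
         + c3 * (?N x * x ^ 3) + c4 * (?N x * x ^ 4) = ?N x * ?f x" for x
  proof -
    have "c0 + c1 * x + c2 * x ^ 2 + c3 * x ^ 3 + c4 * x ^ 4 = ?f x"
      unfolding c0_def c1_def c2_def c3_def c4_def cmod_power2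
      by simp algebra
    then have "?N x * (c0 + c1 * x + c2 * x ^ 2 + c3 * x ^ 3 + c4 * x ^ 4) = ?N x * ?f x"
      by simp
    then show ?thesis
      by (simp add: algebra_simps)
  qed
  moreover have "c0 * 1 + c1 * 0 + c2 * 1 + c3 * 0 + c4 * 3
      = (cmod p)\<^sup>2 + (cmod q)\<^sup>2 + 2 * (cmod r)\<^sup>2"
    unfolding c0_def c2_def c4_def cmod_power2 by (simp add: power2_eq_square algebra_simps)
  ultimately have "has_bochner_integral lborel (\<lambda>x. ?N x *\<^sub>R ?f x)
      ((cmod p)\<^sup>2 + (cmod q)\<^sup>2 + 2 * (cmod r)\<^sup>2)"
    by simp
  then show ?thesis
    by (intro has_bochner_integral_density) (auto simp: normal_density_nonneg)
qed

lemma matrix_inv_mult_vector_eqI: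
  fixes M :: "'a::semiring_1 ^ 'n ^ 'n"
  assumes "invertible M" and "M *v x = y"
  shows "matrix_inv M *v y = x"
proof -
  have "matrix_inv M ** M = mat 1"
    using someI_ex[OF assms(1)[unfolded invertible_def]] unfolding matrix_inv_def
    by (rule conjunct2)
  then show ?thesis
    using assms(2) by (auto simp: matrix_vector_mul_assoc)
qed

text \<open>The noise enters strictly below the diagonal, so the determinant is
  \<open>(1 - hh a2) (1 - hh a3)\<close> for every \<xi>.\<close>

lemma invertible_stage_matrix_srk3:
  assumes "1 - hh * of_real a2 \<noteq> 0" and "1 - hh * of_real a3 \<noteq> 0"
  shows "invertible (stage_matrix (srk3 0 a2 a3 b \<sigma>) hh k \<xi>)"
  using assms
  by (simp add: invertible_det_nz det_3 stage_matrix_def srk3_def mat_def vector_3)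

text \<open>The stages found by forward substitution are checked against the linear system, which
  avoids computing the inverse.\<close>

lemma stab_fun_srk3:
  assumes "b \<noteq> 0" and "\<sigma>\<^sup>2 = 1"
    and nz: "1 - hh * of_real a2 \<noteq> 0" "1 - hh * of_real a3 \<noteq> 0"
  shows "stab_fun (srk3 0 a2 a3 b \<sigma>) hh k \<xi> =
    (1 + hh * of_real (1 - a3) + k * of_real \<xi>
       + k\<^sup>2 / (2 * (1 - hh * of_real a2)) * of_real (\<xi>\<^sup>2 - 1)) / (1 - hh * of_real a3)"
    (is "_ = ?R")
proof -
  let ?M = "stage_matrix (srk3 0 a2 a3 b \<sigma>) hh k \<xi>"
  define D where "D = 1 - hh * of_real a2"
  \<comment> \<open>Second stage: row 2 reads \<open>D * H2 = D + k b (\<xi> - \<sigma>)\<close>,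
    since \<open>a1 = 0\<close>.\<close>
  define H2 where "H2 = 1 + k * of_real (b * (\<xi> - \<sigma>)) / D"
  let ?H = "vector [1, H2, ?R] :: complex ^ 3"
  have D: "D \<noteq> 0" and b: "of_real b \<noteq> (0::complex)"
    using nz assms(1) by (auto simp: D_def)
  have R: "?R * (1 - hh * of_real a3) = 1 + hh * of_real (1 - a3) + k * of_real \<xi>
       + k\<^sup>2 / (2 * D) * of_real (\<xi>\<^sup>2 - 1)"
    using nz by (simp add: D_def)
  have s: "of_real (\<xi>\<^sup>2 - 1) = (of_real (\<xi> + \<sigma>) * of_real (\<xi> - \<sigma>) :: complex)"
    using assms(2) by (simp flip: of_real_mult add: power2_eq_square algebra_simps)
  have 2: "H2 * D = D + k * of_real (b * (\<xi> - \<sigma>))"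
    using D by (simp add: H2_def field_simps)
  \<comment> \<open>The factor \<open>b\<close> in \<open>H2\<close> cancels against
    \<open>1 / (2 b)\<close>, and \<open>\<sigma>^2 = 1\<close> turns the product of linear factors
    into the Hermite term.\<close>
  have 3: "k * of_real ((\<xi> + \<sigma>) / (2 * b)) * H2
      = k * of_real ((\<xi> + \<sigma>) / (2 * b)) + k\<^sup>2 / (2 * D) * of_real (\<xi>\<^sup>2 - 1)"
    unfolding s H2_def using D b by (simp add: field_simps power2_eq_square)
  have "(?M *v ?H) $ 1 = 1"
    by (simp add: stage_matrix_def srk3_def mat_def matrix_vector_mult_def sum_3 vector_3)
  moreover have "(?M *v ?H) $ 2 = 1"
    using 2 by (simp add: stage_matrix_def srk3_def mat_def matrix_vector_mult_def sum_3 vector_3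
        D_def algebra_simps)
  moreover have "(?M *v ?H) $ 3 = 1"
  proof -
    have "(?M *v ?H) $ 3 = ?R * (1 - hh * of_real a3) - hh * of_real (1 - a3)
        - k * of_real (\<xi> * (1 - 1 / (2 * b)) - \<sigma> / (2 * b))
        - k * of_real ((\<xi> + \<sigma>) / (2 * b)) * H2"
      by (simp add: stage_matrix_def srk3_def mat_def matrix_vector_mult_def sum_3 vector_3
          add_divide_distrib mult.commute)
    \<comment> \<open>The terms in \<open>(\<xi> + \<sigma>) / (2 b)\<close> from stages 1 and 2
      cancel, leaving \<open>k \<xi>\<close> at first order in \<open>k\<close>.\<close>
    also have "\<dots> = 1"
      unfolding R 3 by (simp add: algebra_simps add_divide_distrib)
    finally show ?thesis .
  qed
  ultimately have "?M *v ?H = (\<chi> i. 1)"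
    by (simp add: vec_eq_iff forall_3)
  then have "matrix_inv ?M *v (\<chi> i. 1) = ?H"
    by (intro matrix_inv_mult_vector_eqI invertible_stage_matrix_srk3 nz)
  then show ?thesis
    by (simp add: stab_fun_def srk3_def vector_3)
qed

lemma one_le_cmod_one_minus_mult_of_real:
  assumes "Re z \<le> 0" and "a \<ge> 0"
  shows "1 \<le> cmod (1 - z * of_real a)"
proof -
  have "1 \<le> Re (1 - z * of_real a)"
    using assms by (simp add: mult_nonpos_nonneg)
  then show ?thesis
    using complex_Re_le_cmod order_trans by blast
qed

theorem lemma5p8:
  fixes a2 a3 b \<sigma> :: real
  assumes "b \<noteq> 0" and "\<sigma> \<in> {1, - 1}"
    and "a2 \<ge> 0" and "a3 \<ge> 3 / 2"
  shows "A_stable (srk3 0 a2 a3 b \<sigma>)"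
  unfolding A_stable_def
proof (rule subrelI)
  fix hh k :: complex
  assume "(hh, k) \<in> dom_SDE"
  then have K: "2 * Re hh + (cmod k)\<^sup>2 < 0"
    by (simp add: dom_SDE_def)
  define D2 where "D2 = 1 - hh * of_real a2"
  define D3 where "D3 = 1 - hh * of_real a3"
  have neg: "Re hh \<le> 0"
    using K zero_le_power2[of "cmod k"] by linarith
  have D2: "1 \<le> cmod D2" and D3: "1 \<le> cmod D3"
    unfolding D2_def D3_def using neg assms(3,4)
    by (auto intro!: one_le_cmod_one_minus_mult_of_real)
  have nz: "1 - hh * of_real a2 \<noteq> 0" "1 - hh * of_real a3 \<noteq> 0"
    using D2 D3 by (auto simp: D2_def D3_def)
  let ?S = "srk3 0 a2 a3 b \<sigma>"
  define p where "p = 1 + hh * of_real (1 - a3)"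
  define r where "r = k\<^sup>2 / (2 * D2)"
  define V where "V = ((cmod p)\<^sup>2 + (cmod k)\<^sup>2 + 2 * (cmod r)\<^sup>2) / (cmod D3)\<^sup>2"
  have "(cmod (stab_fun ?S hh k \<xi>))\<^sup>2
      = (cmod (p + k * of_real \<xi> + r * of_real (\<xi>\<^sup>2 - 1)))\<^sup>2 / (cmod D3)\<^sup>2" for \<xi>
    using assms(2) stab_fun_srk3[OF assms(1) _ nz, of \<sigma> k \<xi>]
    by (auto simp: p_def r_def D2_def D3_def norm_divide power_divide)
  \<comment> \<open>This yields both the integrability and the value that \<open>dom_SRK\<close>
    asks for.\<close>
  then have int: "has_bochner_integral std_normal_distribution
      (\<lambda>\<xi>. (cmod (stab_fun ?S hh k \<xi>))\<^sup>2) V"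
    unfolding V_def
    by (simp only:)
       (intro has_bochner_integral_divide_zero has_bochner_integral_std_normal_cmod_quadratic)
  have "2 * (cmod r)\<^sup>2 = ((cmod k)\<^sup>2)\<^sup>2 / 2 / (cmod D2)\<^sup>2"
    by (simp add: r_def norm_divide norm_mult norm_power power_divide power_mult_distrib)
  also have "\<dots> \<le> ((cmod k)\<^sup>2)\<^sup>2 / 2"
    using D2 by (simp add: divide_le_eq mult_le_cancel_left1 one_le_power)
  \<comment> \<open>Squaring \<open>|k|^2 < -2 Re hh\<close>, whose sides are nonnegative.\<close>
  also have "\<dots> \<le> (- 2 * Re hh)\<^sup>2 / 2"
    using K by (intro divide_right_mono power_mono) auto
  finally have r: "2 * (cmod r)\<^sup>2 \<le> 2 * (Re hh)\<^sup>2"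
    by simp
  \<comment> \<open>Here \<open>p = D3 + hh\<close>, and
    \<open>Re (hh * cnj D3) = Re hh - a3 |hh|^2\<close>.\<close>
  have eq: "(cmod p)\<^sup>2 = (cmod D3)\<^sup>2 + 2 * Re hh + (1 - 2 * a3) * (cmod hh)\<^sup>2"
    unfolding p_def D3_def cmod_power2 by simp algebra
  have "(1 - 2 * a3) * (cmod hh)\<^sup>2 \<le> (- 2) * (cmod hh)\<^sup>2"
    using assms(4) by (intro mult_right_mono) auto
  then have "(1 - 2 * a3) * (cmod hh)\<^sup>2 + 2 * (Re hh)\<^sup>2 \<le> 0"
    using abs_Re_le_cmod[of hh] power2_le_iff_abs_le[of "cmod hh" "Re hh"] by simp
  \<comment> \<open>Strictness comes from \<open>2 Re hh + |k|^2 < 0\<close>; the remaining terms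
    sum to at most 0.\<close>
  then have "(cmod p)\<^sup>2 + (cmod k)\<^sup>2 + 2 * (cmod r)\<^sup>2 < (cmod D3)\<^sup>2"
    using r eq K by linarith
  then have "V < 1"
    using D3 by (simp add: V_def divide_less_eq)
  then show "(hh, k) \<in> dom_SRK ?S"
    using int invertible_stage_matrix_srk3[OF nz]
    by (simp add: dom_SRK_def ms_stab_fun_def has_bochner_integral_iff)
qed

end
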